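(* Let $n\in\mathbb N$. The direct antisymmetric sign reverse integrator at truncation level $n$ is given by $$\sum_{|w|\le n}I_w(t)\tilde V_w+\sum_{|w|=n+1}I_{\mathrm{coshlog}^{ш}(\mathrm{id})(w)}(t)\,\tilde V_w ,$$ or equivalently $$\sum_{|w|\le n}I_w(t)\tilde V_w+\sum_{|w|=n+1}\Bigl(I_{\mathrm{coshlog}^{\star}(\mathrm{id})(w)}(t)+\tfrac12I_{(S-\hat S)(w)}(t)\Bigr)\tilde V_w .$$ Here $ш$ denotes the convolution product of the shuffle product and $\star$ that of the quasi-shuffle product.
   Context: Setting: a Lévy-driven It\^o equation on $\mathbb R^N$ (independent driving Wiener processes $W^1,\dots,W^d$, $W^0_t\equiv t$, and purely discontinuous martingales $J^i_t=\int_0^t\int v\,\overline Q^i(\mathrm dv,\mathrm ds)$, $d<i\le\ell$, with moments of all orders, where $\overline Q^i$ is the compensation of a Poisson measure with intensity $\rho^i(\mathrm dv)\mathrm ds$). The alphabet $\mathbb A$ consists of $0,\dots,\ell$ (associated with $W^0,\dots,W^d,J^{d+1},\dots,J^\ell$) together with the letters $i^{(p)}$, $p\ge2$, associated with the compensated power brackets $J^{i^{(p)}}_t=\int_0^t\int v^p\,\overline Q^i(\mathrm dv,\mathrm ds)$ not in the linear span of $\{t,J^i,\dots,J^{i^{(p-1)}}\}$. $\mathbb A^*$ is the set of words, $|w|$ the word length, $\mathbb R\langle\mathbb A\rangle$ the vector space with basis $\mathbb A^*$. $I_{a_1\ldots a_m}(t)=\int_{0<\tau_1<\cdots<\tau_m<t}\mathrm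 dZ^{a_1}_{\tau_1}\cdots\mathrm dZ^{a_m}_{\tau_m}$ with $Z^a$ the process of letter $a$ ($I=1$ for the empty word), extended linearly to $\mathbb R\langle\mathbb A\rangle$. The flowmap is assumed to have a separated expansion $\sum_{w\in\mathbb A^*}I_w(t)\tilde V_w$ with $\tilde V_{a_1\ldots a_m}=\tilde V_{a_1}\circ\cdots\circ\tilde V_{a_m}$. Products: the quasi-shuffle product $*$ on $\mathbb R\langle\mathbb A\rangle$ satisfies $u*\mathbf 1=\mathbf 1*u=u$ ($\mathbf 1$ the empty word) and $ua*vb=(u*vb)a+(ua*v)b+(u*v)[a,b]$, where $[\cdot,\cdot]$ is the commutative associative product on the span of the letters corresponding to quadratic covariation of the associated processes; the shuffle product is the case $[\cdot,\cdot]=0$. The convolution of endomorphisms for a product $\bullet$ on $\mathbb R\langle\mathbb A\rangle$ is $(X,Y)\mapsto\bigl(w\mapsto\sum_{uv=w}X(u)\bullet Y(v)\bigr)$, the sum over all factorizations of $w$ by concatenation; $\star$ is the convolution for $*$ and $ш$ that for the shuffle product. In both cases the unit $\nu$ fixes $\mathbf 1$ and kills nonempty words; $\mathfrak J=\mathrm{id}-\nu$. Since $\sinh(\log(1+x))=x+\tfrac12\sum_{k\ge2}(-1)^{k-1}x^k$ and $\cosh(\log(1+x))=1+\tfrac12\sum_{k\ge2}(-1)^kx^k$, one sets $\mathrm{sinhlog}^{\bullet}(\mathrm{id})=\mathfrak J+\tfrac12\sum_{k\ge2}(-1)^{k-1}\mathfrak J^{\bullet k}$ and $\mathrm{coshlog}^{\bullet}(\mathrm{id})=\nu+\tfrac12\sum_{k\ge2}(-1)^k\mathfrak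 J^{\bullet k}$, for $\bullet=\star$ or $ш$. Endomorphisms: $S(a_1\ldots a_m)=(-1)^ma_m\ldots a_1$; the quasi-shuffle antipode is $\hat S(a_1\ldots a_m)=(-1)^m\sum[u_1][u_2]\ldots[u_k]$, the sum over all factorizations $a_m\ldots a_1=u_1\ldots u_k$ into nonempty subwords ($1\le k\le m$), where $[a]=a$ for a letter and $[b_1\ldots b_j]=[b_1,[b_2,\ldots,[b_{j-1},b_j]\ldots]]$ for a word. Both fix $\mathbf 1$. The direct antisymmetric sign reverse integrator at level $n$ is the direct map-truncate-invert scheme associated with $\tfrac12(\mathrm{id}-S)=\mathrm{sinhlog}^{ш}(\mathrm{id})$ truncated by word length: writing $\pi_{\le n}$ and $\pi_{=n+1}$ for the projections onto words of length $\le n$ and $=n+1$, it is the approximate flow $\sum_wI_{H(w)}(t)\tilde V_w$ with $H=\pi_{\le n}+\pi_{=n+1}\circ\bigl(\mathfrak J-\tfrac12(\mathrm{id}-S)\bigr)$. *)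

theory Defs
  imports "HOL-Probability.Probability" "HOL-Library.Poly_Mapping"
begin

instantiation poly_mapping :: (type, real_vector) real_vector
begin

lift_definition scaleR_poly_mapping :: "real \<Rightarrow> ('a \<Rightarrow>\<^sub>0 'b) \<Rightarrow> 'a \<Rightarrow>\<^sub>0 'b"
  is "\<lambda>r f x. r *\<^sub>R f x"
  by (erule finite_subset[rotated]) auto

instance
  by standard (transfer, simp add: fun_eq_iff algebra_simps)+

end

text \<open>
  The real vector space with basis \<open>'b\<close> is \<open>'b \<Rightarrow>\<^sub>0 real\<close>; \<open>linext g\<close> is the linear map
  with values \<open>g\<close> on the basis. Elements of \<open>'a list \<Rightarrow>\<^sub>0 real\<close> are linear combinations of words
  over \<open>'a\<close>, elements of \<open>'a \<Rightarrow>\<^sub>0 real\<close> linear combinations of letters.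
\<close>

definition linext :: "('b \<Rightarrow> 'v) \<Rightarrow> ('b \<Rightarrow>\<^sub>0 real) \<Rightarrow> 'v::real_vector"
  where "linext g p = (\<Sum>x\<in>Poly_Mapping.keys p. Poly_Mapping.lookup p x *\<^sub>R g x)"

definition basis :: "'b \<Rightarrow> 'b \<Rightarrow>\<^sub>0 real"
  where "basis x = Poly_Mapping.single x 1"

type_synonym 'a ncpoly = "'a list \<Rightarrow>\<^sub>0 real"

definition conc :: "'a ncpoly \<Rightarrow> 'a ncpoly \<Rightarrow> 'a ncpoly"
  where "conc p q = linext (\<lambda>u. linext (\<lambda>v. basis (u @ v)) q) p"

definition of_letters :: "('a \<Rightarrow>\<^sub>0 real) \<Rightarrow> 'a ncpoly"
  where "of_letters = linext (\<lambda>a. basis [a])"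

text \<open>
  A bilinear product on the span of the letters is given by its values \<open>br a b\<close> on pairs of letters.
\<close>

definition letter_mult ::
    "('a \<Rightarrow> 'a \<Rightarrow> ('a \<Rightarrow>\<^sub>0 real)) \<Rightarrow> ('a \<Rightarrow>\<^sub>0 real) \<Rightarrow> ('a \<Rightarrow>\<^sub>0 real) \<Rightarrow> ('a \<Rightarrow>\<^sub>0 real)"
  where "letter_mult br x y = linext (\<lambda>a. linext (\<lambda>b. br a b) y) x"

function qsh :: "('a \<Rightarrow> 'a \<Rightarrow> ('a \<Rightarrow>\<^sub>0 real)) \<Rightarrow> 'a list \<Rightarrow> 'a list \<Rightarrow> 'a ncpoly"
  where
    "qsh br [] v = basis v"
  | "qsh br (u @ [a]) [] = basis (u @ [a])"
  | "qsh br (u @ [a]) (v @ [b]) =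
       conc (qsh br u (v @ [b])) (basis [a])
     + conc (qsh br (u @ [a]) v) (basis [b])
     + conc (qsh br u v) (of_letters (br a b))"
  by (auto, metis rev_exhaust)
termination
  by (relation "Wellfounded.measure (\<lambda>(br, u, v). length u + length v)") auto

definition qshuffle :: "('a \<Rightarrow> 'a \<Rightarrow> ('a \<Rightarrow>\<^sub>0 real)) \<Rightarrow> 'a ncpoly \<Rightarrow> 'a ncpoly \<Rightarrow> 'a ncpoly"
  where "qshuffle br p q = linext (\<lambda>u. linext (\<lambda>v. qsh br u v) q) p"

definition shuffle :: "'a ncpoly \<Rightarrow> 'a ncpoly \<Rightarrow> 'a ncpoly"
  where "shuffle = qshuffle (\<lambda>a b. 0)"

type_synonym 'a endo = "'a ncpoly \<Rightarrow> 'a ncpoly"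

definition conv :: "('a ncpoly \<Rightarrow> 'a ncpoly \<Rightarrow> 'a ncpoly) \<Rightarrow> 'a endo \<Rightarrow> 'a endo \<Rightarrow> 'a endo"
  where "conv m X Y =
    linext (\<lambda>w. \<Sum>(u, v) \<in> {(u, v). u @ v = w}. m (X (basis u)) (Y (basis v)))"

definition conv_unit :: "'a endo"
  where "conv_unit = linext (\<lambda>w. if w = [] then basis [] else 0)"

definition aug :: "'a endo"
  where "aug p = p - conv_unit p"

primrec conv_pow :: "('a ncpoly \<Rightarrow> 'a ncpoly \<Rightarrow> 'a ncpoly) \<Rightarrow> 'a endo \<Rightarrow> nat \<Rightarrow> 'a endo"
  where
    "conv_pow m X 0 = conv_unit"
  | "conv_pow m X (Suc k) = conv m X (conv_pow m X k)"

text \<open>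
  The series is locally finite: the \<open>k\<close>-th power of \<^const>\<open>aug\<close> kills words of length less
  than \<open>k\<close>. \<^const>\<open>Sum_any\<close> is the sum over the finitely many nonzero terms.
\<close>

definition coshlog :: "('a ncpoly \<Rightarrow> 'a ncpoly \<Rightarrow> 'a ncpoly) \<Rightarrow> 'a endo"
  where "coshlog m p = conv_unit p
    + (1 / 2) *\<^sub>R Sum_any (\<lambda>k. ((-1) ^ k *\<^sub>R conv_pow m aug k p) when 2 \<le> k)"

definition sign_reverse :: "'a endo"
  where "sign_reverse = linext (\<lambda>w. (-1) ^ length w *\<^sub>R basis (rev w))"

text \<open>The value on the empty word is never used.\<close>

fun bracket_word :: "('a \<Rightarrow> 'a \<Rightarrow> ('a \<Rightarrow>\<^sub>0 real)) \<Rightarrow> 'a list \<Rightarrow> ('a \<Rightarrow>\<^sub>0 real)"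
  where
    "bracket_word br [] = 0"
  | "bracket_word br [a] = basis a"
  | "bracket_word br (a # b # w) = letter_mult br (basis a) (bracket_word br (b # w))"

definition qs_antipode :: "('a \<Rightarrow> 'a \<Rightarrow> ('a \<Rightarrow>\<^sub>0 real)) \<Rightarrow> 'a endo"
  where "qs_antipode br = linext (\<lambda>w. (-1) ^ length w *\<^sub>R
    (\<Sum>us \<in> {us. concat us = rev w \<and> [] \<notin> set us}.
       foldr conc (map (\<lambda>u. of_letters (bracket_word br u)) us) (basis [])))"

definition word_proj :: "('a list \<Rightarrow> bool) \<Rightarrow> 'a endo"
  where "word_proj P = linext (\<lambda>w. if P w then basis w else 0)"

definition direct_mti :: "nat \<Rightarrow> 'a endo \<Rightarrow> 'a endo"
  where "direct_mti n X p =
    word_proj (\<lambda>w. length w \<le> n) p + word_proj (\<lambda>w. length w = n + 1) (aug p - X p)"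

definition antisym_sign_reverse :: "'a endo"
  where "antisym_sign_reverse p = (1 / 2) *\<^sub>R (p - sign_reverse p)"

text \<open>
  Convergence in probability along deterministic partitions of \<open>[0, t]\<close>, as the mesh tends to 0;
  \<open>R k \<tau>\<close> is the random variable belonging to the partition \<open>\<tau> 0 \<le> \<dots> \<le> \<tau> k\<close>.
\<close>

definition mesh_limit ::
    "'o measure \<Rightarrow> real \<Rightarrow> (nat \<Rightarrow> (nat \<Rightarrow> real) \<Rightarrow> 'o \<Rightarrow> real) \<Rightarrow> ('o \<Rightarrow> real) \<Rightarrow> bool"
  where "mesh_limit M t R X \<longleftrightarrow> X \<in> borel_measurable M \<and>
    (\<forall>\<epsilon>>0. \<exists>\<delta>>0. \<forall>k \<tau>.
       \<tau> 0 = 0 \<and> \<tau> k = t \<and> (\<forall>j<k. \<tau> j \<le> \<tau> (Suc j) \<and> \<tau> (Suc j) - \<tau> j < \<delta>) \<longrightarrow>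
       R k \<tau> \<in> borel_measurable M \<and>
       measure M {\<omega> \<in> space M. \<bar>R k \<tau> \<omega> - X \<omega>\<bar> > \<epsilon>} < \<epsilon>)"

text \<open>
  \<open>X\<close> is (a version of) the Ito integral of \<open>H\<^sub>s\<^sub>-\<close> with respect to \<open>Z\<close> over \<open>[0, t]\<close>. For a cadlag
  adapted \<open>H\<close> and a semimartingale \<open>Z\<close> the left-point sums converge in probability to that integral.
\<close>

definition has_ito_integral ::
    "'o measure \<Rightarrow> (real \<Rightarrow> 'o \<Rightarrow> real) \<Rightarrow> (real \<Rightarrow> 'o \<Rightarrow> real) \<Rightarrow> real \<Rightarrow> ('o \<Rightarrow> real) \<Rightarrow> bool"
  where "has_ito_integral M H Z t X \<longleftrightarrow>
    mesh_limit M t (\<lambda>k \<tau> \<omega>. \<Sum>j<k. H (\<tau> j) \<omega> * (Z (\<tau> (Suc j)) \<omega> - Z (\<tau> j) \<omega>)) X"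

definition has_quadratic_covariation ::
    "'o measure \<Rightarrow> (real \<Rightarrow> 'o \<Rightarrow> real) \<Rightarrow> (real \<Rightarrow> 'o \<Rightarrow> real) \<Rightarrow> real \<Rightarrow> ('o \<Rightarrow> real) \<Rightarrow> bool"
  where "has_quadratic_covariation M Y Z t X \<longleftrightarrow>
    mesh_limit M t (\<lambda>k \<tau> \<omega>. \<Sum>j<k.
      (Y (\<tau> (Suc j)) \<omega> - Y (\<tau> j) \<omega>) * (Z (\<tau> (Suc j)) \<omega> - Z (\<tau> j) \<omega>)) X"

definition wiener_process ::
    "'o measure \<Rightarrow> (real \<Rightarrow> 'o measure) \<Rightarrow> (real \<Rightarrow> 'o \<Rightarrow> real) \<Rightarrow> bool"
  where "wiener_process M F W \<longleftrightarrow>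
    (\<forall>t\<ge>0. W t \<in> borel_measurable (F t)) \<and>
    (\<forall>\<omega>\<in>space M. W 0 \<omega> = 0 \<and> continuous_on {0..} (\<lambda>t. W t \<omega>)) \<and>
    (\<forall>s t. 0 \<le> s \<and> s < t \<longrightarrow>
       distributed M lborel (\<lambda>\<omega>. W t \<omega> - W s \<omega>) (normal_density 0 (sqrt (t - s))) \<and>
       prob_space.indep_set M (sets (F s))
         {(\<lambda>\<omega>. W t \<omega> - W s \<omega>) -` B \<inter> space M | B. B \<in> sets borel})"

text \<open>
  A Poisson random measure on \<open>\<real> \<times> [0, \<infinity>)\<close> (jump size, time) with intensity \<open>\<rho>(dv) ds\<close>, relative
  to the filtration \<open>F\<close>.
\<close>

definition poisson_intensity :: "real measure \<Rightarrow> (real \<times> real) measure"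
  where "poisson_intensity \<rho> = density (\<rho> \<Otimes>\<^sub>M lborel) (indicator (UNIV \<times> {0..}))"

definition poisson_random_measure ::
    "'o measure \<Rightarrow> (real \<Rightarrow> 'o measure) \<Rightarrow> ('o \<Rightarrow> (real \<times> real) measure) \<Rightarrow> real measure \<Rightarrow> bool"
  where "poisson_random_measure M F Q \<rho> \<longleftrightarrow>
    (\<forall>\<omega>\<in>space M. sets (Q \<omega>) = sets borel) \<and>
    (\<forall>A\<in>sets borel. (\<lambda>\<omega>. emeasure (Q \<omega>) A) \<in> borel_measurable M) \<and>
    (\<forall>A\<in>sets borel. emeasure (poisson_intensity \<rho>) A < \<infinity> \<longrightarrow>
       (\<forall>k::nat. measure M {\<omega> \<in> space M. emeasure (Q \<omega>) A = of_nat k} =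
          measure (poisson_intensity \<rho>) A ^ k / fact k * exp (- measure (poisson_intensity \<rho>) A))) \<and>
    (\<forall>(A :: nat \<Rightarrow> (real \<times> real) set) m.
       (\<forall>j. A j \<in> sets borel) \<and> disjoint_family_on A {..<m} \<longrightarrow>
       prob_space.indep_vars M (\<lambda>_. borel) (\<lambda>j \<omega>. emeasure (Q \<omega>) (A j)) {..<m}) \<and>
    (\<forall>t\<ge>0. \<forall>A\<in>sets borel. A \<subseteq> UNIV \<times> {..t} \<longrightarrow>
       (\<lambda>\<omega>. emeasure (Q \<omega>) A) \<in> borel_measurable (F t)) \<and>
    (\<forall>s\<ge>0. prob_space.indep_set M (sets (F s))
       (sigma_sets (space M) {(\<lambda>\<omega>. emeasure (Q \<omega>) A) -` B \<inter> space M | A B.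
          A \<in> sets borel \<and> A \<subseteq> UNIV \<times> {s<..} \<and> B \<in> sets borel}))"

definition levy_measure :: "real measure \<Rightarrow> bool"
  where "levy_measure \<rho> \<longleftrightarrow> sets \<rho> = sets borel \<and> emeasure \<rho> {0} = 0 \<and>
    (\<integral>\<^sup>+ v. ennreal (min 1 (v\<^sup>2)) \<partial>\<rho>) < \<infinity>"

text \<open>
  \<open>X\<close> is (a version of) the integral of \<open>g(v)\<close> over jump sizes \<open>v\<close> and times in \<open>(0, t]\<close> with respect
  to the compensation of \<open>Q\<close>: the limit in probability, as \<open>\<epsilon>\<close> decreases to 0, of the compensated
  integrals over the jumps of absolute size at least \<open>\<epsilon>\<close>.
\<close>

definition has_compensated_integral ::
    "'o measure \<Rightarrow> ('o \<Rightarrow> (real \<times> real) measure) \<Rightarrow> real measure \<Rightarrow> (real \<Rightarrow> real) \<Rightarrow> real \<Rightarrow>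
     ('o \<Rightarrow> real) \<Rightarrow> bool"
  where "has_compensated_integral M Q \<rho> g t X \<longleftrightarrow> X \<in> borel_measurable M \<and>
    (\<forall>\<eta>>0. ((\<lambda>\<epsilon>. measure M {\<omega> \<in> space M.
        \<bar>(LINT z:{v. \<epsilon> \<le> \<bar>v\<bar>} \<times> {0<..t}|Q \<omega>. g (fst z)) - t * (LINT v:{v. \<epsilon> \<le> \<bar>v\<bar>}|\<rho>. g v)
          - X \<omega>\<bar> > \<eta>}) \<longlongrightarrow> 0) (at_right 0))"

text \<open>
  \<open>Base i\<close> is the letter \<open>i\<close> and \<open>Power i p\<close> the letter \<open>i\<^sup>(\<^sup>p\<^sup>)\<close>. The process \<open>J i p\<close> is the compensated
  power bracket of order \<open>p\<close> of the \<open>i\<close>-th jump martingale \<open>J i 1\<close>.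
\<close>

datatype letter = Base nat | Power nat nat

fun driver ::
    "nat \<Rightarrow> (nat \<Rightarrow> real \<Rightarrow> 'o \<Rightarrow> real) \<Rightarrow> (nat \<Rightarrow> nat \<Rightarrow> real \<Rightarrow> 'o \<Rightarrow> real) \<Rightarrow>
     letter \<Rightarrow> real \<Rightarrow> 'o \<Rightarrow> real"
  where
    "driver d W J (Base i) t \<omega> = (if i = 0 then t else if i \<le> d then W i t \<omega> else J i 1 t \<omega>)"
  | "driver d W J (Power i p) t \<omega> = J i p t \<omega>"

definition in_lower_span ::
    "'o measure \<Rightarrow> (nat \<Rightarrow> nat \<Rightarrow> real \<Rightarrow> 'o \<Rightarrow> real) \<Rightarrow> nat \<Rightarrow> nat \<Rightarrow> bool"
  where "in_lower_span M J i p \<longleftrightarrow> (\<exists>(c0 :: real) (c :: nat \<Rightarrow> real). \<forall>t\<ge>0. AE \<omega> in M.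
    J i p t \<omega> = c0 * t + (\<Sum>q = 1..<p. c q * J i q t \<omega>))"

definition alphabet ::
    "'o measure \<Rightarrow> nat \<Rightarrow> nat \<Rightarrow> (nat \<Rightarrow> nat \<Rightarrow> real \<Rightarrow> 'o \<Rightarrow> real) \<Rightarrow> letter set"
  where "alphabet M d l J =
    Base ` {0..l} \<union> {Power i p | i p. d < i \<and> i \<le> l \<and> 2 \<le> p \<and> \<not> in_lower_span M J i p}"

definition integral_ext ::
    "('a list \<Rightarrow> real \<Rightarrow> 'o \<Rightarrow> real) \<Rightarrow> 'a ncpoly \<Rightarrow> real \<Rightarrow> 'o \<Rightarrow> real"
  where "integral_ext I p t \<omega> = linext (\<lambda>w. I w t \<omega>) p"

definition word_op :: "('a \<Rightarrow> 'f \<Rightarrow> 'f) \<Rightarrow> 'a list \<Rightarrow> 'f \<Rightarrow> 'f"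
  where "word_op D w = foldr (\<circ>) (map D w) id"

text \<open>
  \<^item> \<open>W i\<close> (\<open>1 \<le> i \<le> d\<close>) are the Wiener processes; \<open>Q i\<close>, \<open>\<rho> i\<close> and \<open>J i p\<close> (\<open>d < i \<le> l\<close>) are the Poisson
    measures, their Levy measures and the compensated power brackets, with \<open>J i 1\<close> the driving
    martingale.
  \<^item> \<open>br\<close> is the product on the span of the letters, as a table of structure constants; only its
    values on the alphabet matter.
  \<^item> \<open>I w t\<close> is (a version of) the iterated integral. In a word the last letter is integrated
    outermost.
  \<^item> \<open>V i\<close> are the vector fields and \<open>\<phi> t \<omega> y\<close> the solution at time \<open>t\<close> started in \<open>y\<close>. The flowmap acts
    on functions by \<open>f \<mapsto> f \<circ> \<phi> t \<omega>\<close>.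
  \<^item> \<open>T\<close> is the space of test functions on which the flowmap has the separated expansion with
    operators \<open>D a\<close>. The alphabet may be infinite, so sums over words, including those over words
    of a fixed length, are unordered sums of real numbers (\<^const>\<open>has_sum\<close>).
\<close>

locale levy_ito_setting = prob_space M + filtration "space M" F
  for M :: "'o measure" and F :: "real \<Rightarrow> 'o measure" +
  fixes d l :: nat
    and W :: "nat \<Rightarrow> real \<Rightarrow> 'o \<Rightarrow> real"
    and Q :: "nat \<Rightarrow> 'o \<Rightarrow> (real \<times> real) measure"
    and \<rho> :: "nat \<Rightarrow> real measure"
    and J :: "nat \<Rightarrow> nat \<Rightarrow> real \<Rightarrow> 'o \<Rightarrow> real"
    and br :: "letter \<Rightarrow> letter \<Rightarrow> (letter \<Rightarrow>\<^sub>0 real)"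
    and I :: "letter list \<Rightarrow> real \<Rightarrow> 'o \<Rightarrow> real"
    and V :: "nat \<Rightarrow> real ^ 'N \<Rightarrow> real ^ 'N"
    and \<phi> :: "real \<Rightarrow> 'o \<Rightarrow> real ^ 'N \<Rightarrow> real ^ 'N"
    and T :: "(real ^ 'N \<Rightarrow> real) set"
    and D :: "letter \<Rightarrow> (real ^ 'N \<Rightarrow> real) \<Rightarrow> real ^ 'N \<Rightarrow> real"
  assumes sets_F_le: "\<And>t. sets (F t) \<subseteq> sets M"
    and d_le_l: "d \<le> l"
    and wiener: "\<And>i. 1 \<le> i \<Longrightarrow> i \<le> d \<Longrightarrow> wiener_process M F (W i)"
    and wiener_indep: "indep_vars (\<lambda>_. Pi\<^sub>M {0..} (\<lambda>_. borel))
          (\<lambda>i \<omega>. restrict (\<lambda>t. W i t \<omega>) {0..}) {1..d}"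
    and levy: "\<And>i. d < i \<Longrightarrow> i \<le> l \<Longrightarrow> levy_measure (\<rho> i)"
    and poisson: "\<And>i. d < i \<Longrightarrow> i \<le> l \<Longrightarrow> poisson_random_measure M F (Q i) (\<rho> i)"
    and jump: "\<And>i p t. d < i \<Longrightarrow> i \<le> l \<Longrightarrow> 1 \<le> p \<Longrightarrow> 0 \<le> t \<Longrightarrow>
          has_compensated_integral M (Q i) (\<rho> i) (\<lambda>v. v ^ p) t (J i p t)"
    and moments: "\<And>i k t. d < i \<Longrightarrow> i \<le> l \<Longrightarrow> 0 \<le> t \<Longrightarrow> integrable M (\<lambda>\<omega>. \<bar>J i 1 t \<omega>\<bar> ^ k)"
    and br_closed: "\<And>a b. a \<in> alphabet M d l J \<Longrightarrow> b \<in> alphabet M d l J \<Longrightarrow>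
          Poly_Mapping.keys (br a b) \<subseteq> alphabet M d l J"
    and br_commute: "\<And>a b. a \<in> alphabet M d l J \<Longrightarrow> b \<in> alphabet M d l J \<Longrightarrow> br a b = br b a"
    and br_assoc: "\<And>a b c. a \<in> alphabet M d l J \<Longrightarrow> b \<in> alphabet M d l J \<Longrightarrow>
          c \<in> alphabet M d l J \<Longrightarrow>
          letter_mult br (br a b) (basis c) = letter_mult br (basis a) (br b c)"
    and br_covariation: "\<And>a b t. a \<in> alphabet M d l J \<Longrightarrow> b \<in> alphabet M d l J \<Longrightarrow> 0 \<le> t \<Longrightarrow>
          has_quadratic_covariation M (driver d W J a) (driver d W J b) t
            (\<lambda>\<omega>. linext (\<lambda>c. driver d W J c t \<omega>) (br a b))"
    and I_empty: "\<And>t \<omega>. I [] t \<omega> = 1"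
    and I_snoc: "\<And>w a t. w \<in> lists (alphabet M d l J) \<Longrightarrow> a \<in> alphabet M d l J \<Longrightarrow> 0 \<le> t \<Longrightarrow>
          has_ito_integral M (I w) (driver d W J a) t (I (w @ [a]) t)"
    and V_cont: "\<And>i. i \<le> l \<Longrightarrow> continuous_on UNIV (V i)"
    and \<phi>_adapted: "\<And>t y. 0 \<le> t \<Longrightarrow> (\<lambda>\<omega>. \<phi> t \<omega> y) \<in> borel_measurable (F t)"
    and \<phi>_right_cont: "\<And>t \<omega> y. \<omega> \<in> space M \<Longrightarrow> 0 \<le> t \<Longrightarrow> continuous (at_right t) (\<lambda>s. \<phi> s \<omega> y)"
    and \<phi>_left_lim: "\<And>t \<omega> y. \<omega> \<in> space M \<Longrightarrow> 0 < t \<Longrightarrow> \<exists>x. ((\<lambda>s. \<phi> s \<omega> y) \<longlongrightarrow> x) (at_left t)"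
    and sde: "\<And>t y k. 0 \<le> t \<Longrightarrow> \<exists>X.
          (\<forall>i\<le>l. has_ito_integral M (\<lambda>s \<omega>. V i (\<phi> s \<omega> y) $ k) (driver d W J (Base i)) t (X i)) \<and>
          (AE \<omega> in M. \<phi> t \<omega> y $ k = y $ k + (\<Sum>i\<le>l. X i \<omega>))"
    and T_linear: "\<And>f g \<alpha> \<beta>. f \<in> T \<Longrightarrow> g \<in> T \<Longrightarrow> (\<lambda>y. \<alpha> * f y + \<beta> * g y) \<in> T"
    and D_closed: "\<And>a f. a \<in> alphabet M d l J \<Longrightarrow> f \<in> T \<Longrightarrow> D a f \<in> T"
    and D_linear: "\<And>a f g \<alpha> \<beta>. a \<in> alphabet M d l J \<Longrightarrow> f \<in> T \<Longrightarrow> g \<in> T \<Longrightarrow>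
          D a (\<lambda>y. \<alpha> * f y + \<beta> * g y) = (\<lambda>y. \<alpha> * D a f y + \<beta> * D a g y)"
    and flow_expansion: "\<And>f t y. f \<in> T \<Longrightarrow> 0 \<le> t \<Longrightarrow> AE \<omega> in M.
          ((\<lambda>w. I w t \<omega> * word_op D w f y) has_sum f (\<phi> t \<omega> y)) (lists (alphabet M d l J))"

text \<open>
  The sum \<open>\<Sum>\<^sub>w c\<^sub>w D\<^sub>w\<close> over the words in \<open>A\<close>, applied to \<open>f\<close> and evaluated at \<open>y\<close>, converges and has
  the value \<open>x\<close>.
\<close>

definition expansion_has_value ::
    "('a \<Rightarrow> ('n \<Rightarrow> real) \<Rightarrow> 'n \<Rightarrow> real) \<Rightarrow> 'a list set \<Rightarrow> ('a list \<Rightarrow> real) \<Rightarrow>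
     ('n \<Rightarrow> real) \<Rightarrow> 'n \<Rightarrow> real \<Rightarrow> bool"
  where "expansion_has_value D A c f y x \<longleftrightarrow> ((\<lambda>w. c w * word_op D w f y) has_sum x) A"

end

theory Submission
  imports Defs
begin

text \<open>
  Write \<open>j = id - \<nu>\<close>. On nonempty words \<open>j - (id - S)/2 = (id + S)/2\<close>, while \<open>coshlog(id)\<close> is half
  the sum of \<open>j\<close> and the alternating series of all convolution powers of \<open>j\<close>. That series is the
  convolution inverse of \<open>\<nu> + j = id\<close>, hence the antipode: \<open>S\<close> for the shuffle product and \<open>S'\<close> for
  the quasi-shuffle product. So \<open>coshlog(id)\<close> is \<open>(id + S)/2\<close>, respectively \<open>(id + S')/2\<close>, on
  nonempty words. That the explicit formula for \<open>S'\<close> is a right inverse of \<open>id\<close> is a telescoping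
  sum; the shuffle case is the special case of a vanishing bracket.
\<close>

lemma linext_superset:
  assumes "finite S" "Poly_Mapping.keys p \<subseteq> S"
  shows "linext g p = (\<Sum>x\<in>S. Poly_Mapping.lookup p x *\<^sub>R g x)"
  unfolding linext_def using assms
  by (intro sum.mono_neutral_left) (auto simp: in_keys_iff)

lemma lookup_scaleR [simp]: "Poly_Mapping.lookup (r *\<^sub>R p) x = r *\<^sub>R Poly_Mapping.lookup p x"
  by transfer simp

lemma linear_linext [simp]: "linear (linext g)"
proof (rule linearI)
  fix p q :: "'a \<Rightarrow>\<^sub>0 real"
  let ?S = "Poly_Mapping.keys p \<union> Poly_Mapping.keys q"
  have "linext g (p + q) = (\<Sum>x\<in>?S. Poly_Mapping.lookup (p + q) x *\<^sub>R g x)"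
    by (intro linext_superset) (auto dest: subsetD[OF Poly_Mapping.keys_add])
  also have "\<dots> = linext g p + linext g q"
    by (subst (1 2) linext_superset[of ?S])
       (auto simp: lookup_add scaleR_add_left sum.distrib)
  finally show "linext g (p + q) = linext g p + linext g q" .
next
  fix r :: real and p :: "'a \<Rightarrow>\<^sub>0 real"
  have "linext g (r *\<^sub>R p) = (\<Sum>x\<in>Poly_Mapping.keys p. Poly_Mapping.lookup (r *\<^sub>R p) x *\<^sub>R g x)"
    by (intro linext_superset) (auto simp: in_keys_iff)
  then show "linext g (r *\<^sub>R p) = r *\<^sub>R linext g p"
    by (simp add: linext_def scaleR_sum_right)
qed

lemma linext_basis [simp]: "linext g (basis x) = g x"
  by (simp add: linext_def basis_def)

lemma keys_basis [simp]: "Poly_Mapping.keys (basis x) = {x}"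
  by (simp add: basis_def)

lemma linext_basis_self: "linext basis p = p"
proof (rule poly_mapping_eqI)
  fix k
  have lookup_sum: "Poly_Mapping.lookup (sum h S) k = (\<Sum>x\<in>S. Poly_Mapping.lookup (h x) k)"
    for h :: "'a \<Rightarrow> 'a \<Rightarrow>\<^sub>0 real" and S
    by (induction S rule: infinite_finite_induct) (auto simp: lookup_add)
  have "Poly_Mapping.lookup (linext basis p) k =
      (\<Sum>x\<in>Poly_Mapping.keys p. if x = k then Poly_Mapping.lookup p x else 0)"
    unfolding linext_def lookup_sum by (intro sum.cong) (auto simp: basis_def lookup_single when_def)
  then show "Poly_Mapping.lookup (linext basis p) k = Poly_Mapping.lookup p k"
    by (simp add: in_keys_iff)
qed

lemma linear_eq_linext:
  assumes "linear f"
  shows "f p = linext (\<lambda>x. f (basis x)) p"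
proof -
  have "f p = f (linext basis p)"
    by (simp add: linext_basis_self)
  also have "\<dots> = linext (\<lambda>x. f (basis x)) p"
    by (simp add: linext_def linear_sum[OF assms] linear_scale[OF assms])
  finally show ?thesis .
qed

lemma linear_eqI:
  assumes "linear f" "linear g" "\<And>x. x \<in> Poly_Mapping.keys p \<Longrightarrow> f (basis x) = g (basis x)"
  shows "f p = g p"
  using assms(3) by (subst linear_eq_linext[OF assms(1)], subst linear_eq_linext[OF assms(2)])
     (simp add: linext_def)

lemma linear_linext_family:
  assumes "\<And>x. linear (h x)"
  shows "linear (\<lambda>q. linext (\<lambda>x. h x q) p)"
  by (rule linearI)
     (simp_all add: linext_def linear_add[OF assms] linear_scale[OF assms] scaleR_add_right
        sum.distrib scaleR_sum_right mult.commute)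

lemma bilinear_conc: "bilinear conc"
  unfolding bilinear_def conc_def by (simp add: linear_linext_family)

lemma bilinear_qshuffle: "bilinear (qshuffle br)"
  unfolding bilinear_def qshuffle_def by (simp add: linear_linext_family)

lemma bilinear_letter_mult: "bilinear (letter_mult br)"
  unfolding bilinear_def letter_mult_def by (simp add: linear_linext_family)

lemma linear_of_letters [simp]: "linear of_letters"
  by (simp add: of_letters_def)

lemma linear_bilinear_compose:
  assumes "bilinear h" "linear f"
  shows "linear (\<lambda>x. h p (f x))" "linear (\<lambda>x. h (f x) p)"
  using assms linear_compose[of f "h p"] linear_compose[of f "\<lambda>x. h x p"]
  by (simp_all add: bilinear_def o_def)

lemmas linear_conc [simp] =
  linear_bilinear_compose[OF bilinear_conc]
  linear_bilinear_compose(1)[OF bilinear_conc linear_ident]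
lemmas linear_qshuffle [simp] =
  linear_bilinear_compose[OF bilinear_qshuffle]
  linear_bilinear_compose(1)[OF bilinear_qshuffle linear_ident]
lemmas linear_letter_mult [simp] =
  linear_bilinear_compose[OF bilinear_letter_mult]
  linear_bilinear_compose(1)[OF bilinear_letter_mult linear_ident]
lemmas [simp] = linear_ident linear_compose_add linear_compose[OF _ linear_of_letters, unfolded o_def]

lemmas conc_sum =
  linear_sum[OF linear_conc(3)] linear_sum[OF linear_conc(2)[OF linear_ident]]
lemmas qshuffle_sum_right = linear_sum[OF linear_qshuffle(3)]
lemmas qshuffle_scale_right = linear_scale[OF linear_qshuffle(3)]

lemma conc_basis [simp]: "conc (basis u) (basis v) = basis (u @ v)"
  by (simp add: conc_def)

lemma conc_Nil [simp]: "conc p (basis []) = p" "conc (basis []) p = p"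
proof -
  show "conc p (basis []) = p"
    by (rule linear_eqI[where f = "\<lambda>p. conc p (basis [])" and g = "\<lambda>p. p"]) simp_all
  show "conc (basis []) p = p"
    by (rule linear_eqI[where f = "conc (basis [])" and g = "\<lambda>p. p"]) simp_all
qed

lemma conc_assoc: "conc (conc p q) r = conc p (conc q r)"
proof -
  have 1: "conc (conc (basis u) (basis v)) r = conc (basis u) (conc (basis v) r)" for u v :: "'a list"
    by (rule linear_eqI[where f = "\<lambda>r. conc (conc (basis u) (basis v)) r"
          and g = "\<lambda>r. conc (basis u) (conc (basis v) r)"]) (simp_all del: conc_basis, simp)
  have 2: "conc (conc (basis u) q) r = conc (basis u) (conc q r)" for u :: "'a list"
    by (rule linear_eqI[where f = "\<lambda>q. conc (conc (basis u) q) r"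
          and g = "\<lambda>q. conc (basis u) (conc q r)"]) (simp_all add: 1 del: conc_basis)
  show ?thesis
    by (rule linear_eqI[where f = "\<lambda>p. conc (conc p q) r"
          and g = "\<lambda>p. conc p (conc q r)"]) (simp_all add: 2)
qed

lemma of_letters_basis [simp]: "of_letters (basis a) = basis [a]"
  by (simp add: of_letters_def)

lemma letter_mult_basis [simp]: "letter_mult br (basis a) (basis b) = br a b"
  by (simp add: letter_mult_def)

lemma qshuffle_basis [simp]: "qshuffle br (basis u) (basis v) = qsh br u v"
  by (simp add: qshuffle_def)

lemma qsh_Nil_right [simp]: "qsh br u [] = basis u"
  by (cases u rule: rev_cases) simp_all

lemma qshuffle_Nil_left [simp]: "qshuffle br (basis []) p = p"
  by (rule linear_eqI[where f = "qshuffle br (basis [])" and g = "\<lambda>p. p"]) simp_all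

lemma qshuffle_snoc:
  "qshuffle br (basis (u @ [a])) (conc p (of_letters c)) =
     conc (qshuffle br (basis u) (conc p (of_letters c))) (basis [a])
   + conc (qshuffle br (basis (u @ [a])) p) (of_letters c)
   + conc (qshuffle br (basis u) p) (of_letters (letter_mult br (basis a) c))"
proof -
  define L where "L p c = qshuffle br (basis (u @ [a])) (conc p (of_letters c))" for p c
  define R where "R p c = conc (qshuffle br (basis u) (conc p (of_letters c))) (basis [a])
    + conc (qshuffle br (basis (u @ [a])) p) (of_letters c)
    + conc (qshuffle br (basis u) p) (of_letters (letter_mult br (basis a) c))" for p c
  have lin: "linear (\<lambda>p. L p c)" "linear (\<lambda>p. R p c)" "linear (L p)" "linear (R p)" for p c
    unfolding L_def R_def by simp_all
  have "L p (basis b) = R p (basis b)" for b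
    by (rule linear_eqI[OF lin(1,2)]) (simp add: L_def R_def)
  then have "L p c = R p c"
    by (rule linear_eqI[OF lin(3,4)])
  then show ?thesis
    by (simp add: L_def R_def)
qed

lemma sum_splits:
  "(\<Sum>(u, v) \<in> {(u, v). u @ v = w}. f u v) = (\<Sum>i\<le>length w. f (take i w) (drop i w))"
  by (rule sum.reindex_bij_witness[where i = "\<lambda>i. (take i w, drop i w)" and j = "\<lambda>(u, v). length u"])
     auto

definition factorizations :: "'a list \<Rightarrow> 'a list list set"
  where "factorizations w = {us. concat us = w \<and> [] \<notin> set us}"

lemma finite_factorizations: "finite (factorizations w)"
proof (rule finite_subset)
  have "length us \<le> length (concat us)" if "[] \<notin> set us" for us :: "'a list list"
    using that
  proof (induction us)
    case (Cons u us)
    then show ?case by (cases u) auto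
  qed simp
  moreover have "length u \<le> length (concat us)" if "u \<in> set us" for u and us :: "'a list list"
    using that by (induction us) auto
  ultimately show "factorizations w \<subseteq>
      {us. set us \<subseteq> {u. set u \<subseteq> set w \<and> length u \<le> length w} \<and> length us \<le> length w}"
    by (force simp: factorizations_def)
  show "finite {us. set us \<subseteq> {u. set u \<subseteq> set w \<and> length u \<le> length w} \<and> length us \<le> length w}"
    by (intro finite_lists_length_le) simp
qed

lemma factorizations_Nil: "factorizations [] = {[]}"
proof -
  have "us = []" if "concat us = []" "[] \<notin> set us" for us :: "'a list list"
    using that by (cases us) auto
  then show ?thesis
    by (auto simp: factorizations_def)
qed

definition bracket_sum :: "('a \<Rightarrow> 'a \<Rightarrow> ('a \<Rightarrow>\<^sub>0 real)) \<Rightarrow> 'a list \<Rightarrow> 'a ncpoly"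
  where "bracket_sum br w = (\<Sum>us\<in>factorizations w.
    foldr conc (map (\<lambda>u. of_letters (bracket_word br u)) us) (basis []))"

lemma qs_antipode_basis: "qs_antipode br (basis w) = (-1) ^ length w *\<^sub>R bracket_sum br (rev w)"
  by (simp add: qs_antipode_def bracket_sum_def factorizations_def)

lemma bracket_sum_Nil [simp]: "bracket_sum br [] = basis []"
  by (simp add: bracket_sum_def factorizations_Nil)

lemma foldr_conc_snoc:
  "foldr conc (ps @ [p]) (basis []) = conc (foldr conc ps (basis [])) p"
  by (induction ps) (simp_all add: conc_assoc)

lemma bracket_sum_rev:
  assumes "v \<noteq> []"
  shows "bracket_sum br (rev v) = (\<Sum>k=1..length v.
    conc (bracket_sum br (rev (drop k v))) (of_letters (bracket_word br (rev (take k v)))))"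
proof -
  define g where "g us = foldr conc (map (\<lambda>u. of_letters (bracket_word br u)) us) (basis [])" for us
  have last: "\<exists>us' k. us = us' @ [rev (take k v)] \<and> k \<in> {1..length v} \<and> us' \<in> factorizations (rev (drop k v))"
    if us: "us \<in> factorizations (rev v)" for us
  proof -
    obtain us' u where u: "us = us' @ [u]"
      using us assms by (cases us rule: rev_cases) (auto simp: factorizations_def)
    with us have "rev (concat us' @ u) = v" "u \<noteq> []" "[] \<notin> set us'"
      by (auto simp: factorizations_def)
    then have "v = rev u @ rev (concat us')" "u \<noteq> []" "[] \<notin> set us'"
      by auto
    with u show ?thesis
      by (intro exI[of _ us'] exI[of _ "length u"]) (auto simp: factorizations_def Suc_le_eq)
  qed
  have "(\<Sum>us\<in>factorizations (rev v). g us) =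
      (\<Sum>(k, us) \<in> (SIGMA k:{1..length v}. factorizations (rev (drop k v))). g (us @ [rev (take k v)]))"
  proof (rule sum.reindex_bij_witness[where i = "\<lambda>(k, us). us @ [rev (take k v)]"
        and j = "\<lambda>us. (length (last us), butlast us)"], goal_cases)
    case (1 us)
    then show ?case using last by fastforce
  next
    case (2 us)
    then show ?case using last by fastforce
  next
    case (3 p)
    then show ?case by auto
  next
    case (4 p)
    moreover have "rev (drop k v) @ rev (take k v) = rev v" for k
      by (simp flip: rev_append)
    ultimately show ?case
      by (auto simp: factorizations_def)
  next
    case (5 us)
    then show ?case using last by fastforce
  qed
  also have "\<dots> = (\<Sum>k=1..length v. \<Sum>us\<in>factorizations (rev (drop k v)). g (us @ [rev (take k v)]))"
    by (intro sum.Sigma[symmetric]) (simp_all add: finite_factorizations)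
  also have "\<dots> = (\<Sum>k=1..length v. conc (\<Sum>us\<in>factorizations (rev (drop k v)). g us)
      (of_letters (bracket_word br (rev (take k v)))))"
    by (simp add: g_def foldr_conc_snoc conc_sum del: foldr_append)
  finally show ?thesis
    by (simp add: bracket_sum_def g_def)
qed

lemma bracket_sum_rev_drop:
  assumes "i < length w"
  shows "bracket_sum br (rev (drop i w)) = (\<Sum>j\<in>{i<..length w}.
    conc (bracket_sum br (rev (drop j w)))
      (of_letters (bracket_word br (rev (take (j - i) (drop i w))))))"
proof -
  have "bracket_sum br (rev (drop i w)) = (\<Sum>k=1..length (drop i w).
      conc (bracket_sum br (rev (drop k (drop i w))))
        (of_letters (bracket_word br (rev (take k (drop i w))))))"
    using assms by (intro bracket_sum_rev) simp
  also have "\<dots> = (\<Sum>j\<in>{i<..length w}.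
      conc (bracket_sum br (rev (drop j w)))
        (of_letters (bracket_word br (rev (take (j - i) (drop i w))))))"
    using assms
    by (intro sum.reindex_bij_witness[where i = "\<lambda>j. j - i" and j = "\<lambda>k. k + i"]) auto
  finally show ?thesis .
qed

locale bracket_alphabet =
  fixes A :: "'a set" and br :: "'a \<Rightarrow> 'a \<Rightarrow> ('a \<Rightarrow>\<^sub>0 real)"
  assumes closed: "a \<in> A \<Longrightarrow> b \<in> A \<Longrightarrow> Poly_Mapping.keys (br a b) \<subseteq> A"
    and commute: "a \<in> A \<Longrightarrow> b \<in> A \<Longrightarrow> br a b = br b a"
    and assoc: "a \<in> A \<Longrightarrow> b \<in> A \<Longrightarrow> c \<in> A \<Longrightarrow>
      letter_mult br (br a b) (basis c) = letter_mult br (basis a) (br b c)"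
begin

lemma keys_letter_mult:
  assumes "a \<in> A" "Poly_Mapping.keys p \<subseteq> A"
  shows "Poly_Mapping.keys (letter_mult br (basis a) p) \<subseteq> A"
proof -
  have keys_sum: "Poly_Mapping.keys (sum h S) \<subseteq> A" if "\<And>b. b \<in> S \<Longrightarrow> Poly_Mapping.keys (h b) \<subseteq> A"
    for h :: "'a \<Rightarrow> 'a \<Rightarrow>\<^sub>0 real" and S
    using that
    by (induction S rule: infinite_finite_induct) (auto dest!: subsetD[OF Poly_Mapping.keys_add])
  have keys_scale: "Poly_Mapping.keys (r *\<^sub>R q) \<subseteq> Poly_Mapping.keys q" for r and q :: "'a \<Rightarrow>\<^sub>0 real"
    by (auto simp: in_keys_iff)
  have "letter_mult br (basis a) p =
      (\<Sum>b\<in>Poly_Mapping.keys p. Poly_Mapping.lookup p b *\<^sub>R br a b)"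
    by (simp add: letter_mult_def linext_def[of _ p])
  also have "Poly_Mapping.keys \<dots> \<subseteq> A"
    using assms closed by (intro keys_sum subset_trans[OF keys_scale]) blast
  finally show ?thesis .
qed

lemma keys_bracket_word:
  "set w \<subseteq> A \<Longrightarrow> Poly_Mapping.keys (bracket_word br w) \<subseteq> A"
proof (induction w)
  case (Cons a w)
  then show ?case
    using keys_letter_mult[of a "bracket_word br w"] by (cases w) simp_all
qed simp

lemma letter_mult_left_commute:
  assumes "a \<in> A" "b \<in> A" "Poly_Mapping.keys p \<subseteq> A"
  shows "letter_mult br (basis a) (letter_mult br (basis b) p) =
    letter_mult br (basis b) (letter_mult br (basis a) p)"
proof (rule linear_eqI[where f = "\<lambda>p. letter_mult br (basis a) (letter_mult br (basis b) p)"
      and g = "\<lambda>p. letter_mult br (basis b) (letter_mult br (basis a) p)"])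
  fix c
  assume "c \<in> Poly_Mapping.keys p"
  then have "c \<in> A"
    using assms(3) by blast
  then show "letter_mult br (basis a) (letter_mult br (basis b) (basis c)) =
      letter_mult br (basis b) (letter_mult br (basis a) (basis c))"
    using assoc[OF assms(1,2)] assoc[OF assms(2,1)] commute[OF assms(1,2)] by simp
qed simp_all

lemma bracket_word_snoc:
  assumes "set (w @ [a]) \<subseteq> A" "w \<noteq> []"
  shows "bracket_word br (w @ [a]) = letter_mult br (basis a) (bracket_word br w)"
  using assms
proof (induction w)
  case (Cons b w)
  show ?case
  proof (cases w)
    case Nil
    then show ?thesis using Cons.prems commute by simp
  next
    case (Cons c w')
    then have "bracket_word br ((b # w) @ [a]) = letter_mult br (basis b) (bracket_word br (w @ [a]))"
      by simp
    also have "\<dots> = letter_mult br (basis b) (letter_mult br (basis a) (bracket_word br w))"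
      using Cons.IH Cons.prems Cons by simp
    also have "\<dots> = letter_mult br (basis a) (letter_mult br (basis b) (bracket_word br w))"
      using Cons.prems by (intro letter_mult_left_commute keys_bracket_word) auto
    finally show ?thesis
      using Cons by simp
  qed
qed simp

text \<open>
  Expanding the \<open>i\<close>-th term by the last letter of the prefix of \<open>w\<close> and the last block of each
  factorization gives \<open>U (i - 1) + U i\<close>, so the alternating sum telescopes.
\<close>

lemma qshuffle_bracket_sum:
  assumes w: "set w \<subseteq> A" "w \<noteq> []"
  shows "(\<Sum>i\<le>length w. (-1) ^ (length w - i) *\<^sub>R
    qshuffle br (basis (take i w)) (bracket_sum br (rev (drop i w)))) = 0"
proof -
  define m where "m = length w"
  define B where "B i j = bracket_word br (rev (take (j - i) (drop i w)))" for i j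
  define G where "G j = bracket_sum br (rev (drop j w))" for j
  define T where "T i j = conc (qshuffle br (basis (take i w)) (G j)) (of_letters (B i j))" for i j
  define U where "U i = (\<Sum>j\<in>{i<..m}. T i j)" for i
  define X where "X i = qshuffle br (basis (take i w)) (G i)" for i
  have G: "G i = (\<Sum>j\<in>{i<..m}. conc (G j) (of_letters (B i j)))" if "i < m" for i
    using bracket_sum_rev_drop that unfolding G_def B_def m_def by blast
  have X0: "X 0 = U 0"
    using G[of 0] w by (simp add: X_def U_def T_def m_def)
  have XSuc: "X (Suc i) = U i + U (Suc i)" if i: "i < m" for i
  proof -
    define a where "a = w ! i"
    have take: "take (Suc i) w = take i w @ [a]"
      using i by (simp add: m_def a_def take_Suc_conv_app_nth)
    have drop: "drop i w = a # drop (Suc i) w"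
      using i by (simp add: m_def a_def Cons_nth_drop_Suc)
    have U: "U i = T i (Suc i) + (\<Sum>j\<in>{Suc i<..m}. T i j)"
    proof -
      have "{i<..m} = insert (Suc i) {Suc i<..m}"
        using i by auto
      then show ?thesis
        by (simp add: U_def)
    qed
    have first: "T i (Suc i) = conc (qshuffle br (basis (take i w)) (G (Suc i))) (basis [a])"
      using drop by (simp add: T_def B_def)
    have "X (Suc i) = T i (Suc i) + U (Suc i) + (\<Sum>j\<in>{Suc i<..m}. T i j)"
    proof (cases "Suc i < m")
      case True
      have B: "letter_mult br (basis a) (B (Suc i) j) = B i j" if j: "j \<in> {Suc i<..m}" for j
      proof -
        have *: "j - i = Suc (j - Suc i)"
          using j by auto
        have "set (rev (take (j - Suc i) (drop (Suc i) w)) @ [a]) \<subseteq> A"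
          using w(1) i by (auto simp: a_def m_def dest!: in_set_takeD in_set_dropD)
        moreover have "take (j - Suc i) (drop (Suc i) w) \<noteq> []"
          using j by (auto simp: m_def)
        ultimately show ?thesis
          by (simp add: B_def drop * bracket_word_snoc)
      qed
      have "X (Suc i) = (\<Sum>j\<in>{Suc i<..m}.
          qshuffle br (basis (take i w @ [a])) (conc (G j) (of_letters (B (Suc i) j))))"
        unfolding X_def G[OF True] take by (rule qshuffle_sum_right)
      also have "\<dots> = (\<Sum>j\<in>{Suc i<..m}.
          conc (qshuffle br (basis (take i w)) (conc (G j) (of_letters (B (Suc i) j)))) (basis [a])
          + T (Suc i) j + T i j)"
        by (intro sum.cong) (simp_all add: qshuffle_snoc T_def take B)
      also have "\<dots> = conc (qshuffle br (basis (take i w)) (G (Suc i))) (basis [a])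
          + U (Suc i) + (\<Sum>j\<in>{Suc i<..m}. T i j)"
        by (simp add: sum.distrib U_def G[OF True] conc_sum qshuffle_sum_right)
      finally show ?thesis
        by (simp add: first)
    next
      case False
      then have "Suc i = m"
        using i by simp
      then have "T i (Suc i) = basis (take (Suc i) w)"
        unfolding first take by (simp add: G_def m_def)
      with \<open>Suc i = m\<close> show ?thesis
        by (simp add: X_def U_def G_def m_def)
    qed
    then show ?thesis
      by (simp add: U)
  qed
  have "(\<Sum>i\<le>k. (-1) ^ (m - i) *\<^sub>R X i) = (-1) ^ (m - k) *\<^sub>R U k" if "k \<le> m" for k
    using that
  proof (induction k)
    case (Suc k)
    then have "m - k = Suc (m - Suc k)"
      by simp
    with Suc show ?case
      by (simp add: XSuc scaleR_add_right)
  qed (simp add: X0)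
  from this[of m] show ?thesis
    by (simp add: X_def G_def m_def U_def)
qed

lemma qshuffle_qs_antipode:
  assumes "set w \<subseteq> A" "w \<noteq> []"
  shows "(\<Sum>i\<le>length w. qshuffle br (basis (take i w)) (qs_antipode br (basis (drop i w)))) = 0"
  using qshuffle_bracket_sum[OF assms] by (simp add: qs_antipode_basis qshuffle_scale_right)

end

lemma aug_basis: "aug (basis w) = (if w = [] then 0 else basis w)"
  by (simp add: aug_def conv_unit_def)

lemma conv_unit_basis: "conv_unit (basis w) = (if w = [] then basis [] else 0)"
  by (simp add: conv_unit_def)

lemma qshuffle_0 [simp]: "qshuffle br 0 p = 0" "qshuffle br p 0 = 0"
  by (simp_all add: bilinear_lzero[OF bilinear_qshuffle] bilinear_rzero[OF bilinear_qshuffle])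

lemma conv_basis:
  "conv m X Y (basis w) = (\<Sum>i\<le>length w. m (X (basis (take i w))) (Y (basis (drop i w))))"
  by (simp add: conv_def sum_splits)

lemma conv_pow_aug_eq_0: "length w < k \<Longrightarrow> conv_pow (qshuffle br) aug k (basis w) = 0"
proof (induction k arbitrary: w)
  case (Suc k)
  then show ?case
    by (auto simp: conv_basis aug_basis intro!: sum.neutral)
qed simp

lemma conv_pow_aug_1:
  assumes "w \<noteq> []"
  shows "conv_pow (qshuffle br) aug (Suc 0) (basis w) = basis w"
proof -
  have "conv_pow (qshuffle br) aug (Suc 0) (basis w) =
      (\<Sum>i\<le>length w. if i = length w then basis w else 0)"
    unfolding conv_pow.simps conv_basis
    by (intro sum.cong) (use assms in \<open>auto simp: aug_basis conv_unit_basis\<close>)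
  then show ?thesis
    by simp
qed

context bracket_alphabet
begin

text \<open>Both sides are right convolution inverses of the identity.\<close>

lemma alternating_conv_pow_aug:
  "set w \<subseteq> A \<Longrightarrow> length w \<le> N \<Longrightarrow>
    (\<Sum>k\<le>N. (-1) ^ k *\<^sub>R conv_pow (qshuffle br) aug k (basis w)) = qs_antipode br (basis w)"
proof (induction N arbitrary: w)
  case 0
  then show ?case by (simp add: conv_unit_basis qs_antipode_basis)
next
  case (Suc N)
  let ?P = "\<lambda>k w. conv_pow (qshuffle br) aug k (basis w)"
  have shift: "(\<Sum>k\<le>Suc N. (-1) ^ k *\<^sub>R ?P k w) = ?P 0 w - (\<Sum>k\<le>N. (-1) ^ k *\<^sub>R ?P (Suc k) w)"
    by (subst sum.atMost_Suc_shift) (simp add: sum_negf)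
  show ?case
  proof (cases "w = []")
    case True
    then show ?thesis
      unfolding shift by (simp add: conv_unit_basis qs_antipode_basis conv_basis aug_basis)
  next
    case False
    have "(\<Sum>k\<le>N. (-1) ^ k *\<^sub>R ?P (Suc k) w) =
        (\<Sum>i\<le>length w. qshuffle br (aug (basis (take i w))) (\<Sum>k\<le>N. (-1) ^ k *\<^sub>R ?P k (drop i w)))"
      by (simp add: conv_basis scaleR_sum_right qshuffle_sum_right qshuffle_scale_right
            del: sum.atMost_Suc) (rule sum.swap)
    also have "\<dots> = (\<Sum>i\<le>length w. qshuffle br (basis (take i w)) (qs_antipode br (basis (drop i w)))
        - (if i = 0 then qs_antipode br (basis w) else 0))"
    proof (rule sum.cong[OF refl])
      fix i
      show "qshuffle br (aug (basis (take i w))) (\<Sum>k\<le>N. (-1) ^ k *\<^sub>R ?P k (drop i w)) =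
        qshuffle br (basis (take i w)) (qs_antipode br (basis (drop i w)))
        - (if i = 0 then qs_antipode br (basis w) else 0)"
      proof (cases "i = 0")
        case False
        moreover have "(\<Sum>k\<le>N. (-1) ^ k *\<^sub>R ?P k (drop i w)) = qs_antipode br (basis (drop i w))"
          using False Suc.prems by (intro Suc.IH) (auto dest: in_set_dropD)
        ultimately show ?thesis
          using \<open>w \<noteq> []\<close> by (simp add: aug_basis)
      qed (simp add: aug_basis)
    qed
    also have "\<dots> = - qs_antipode br (basis w)"
      using qshuffle_qs_antipode[OF Suc.prems(1) False] by (simp add: sum_subtractf)
    finally show ?thesis
      unfolding shift using False by (simp add: conv_unit_basis)
  qed
qed

lemma coshlog_qshuffle:
  assumes "set w \<subseteq> A" "w \<noteq> []"
  shows "coshlog (qshuffle br) (basis w) = (1 / 2) *\<^sub>R (basis w + qs_antipode br (basis w))"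
proof -
  let ?P = "\<lambda>k. (-1) ^ k *\<^sub>R conv_pow (qshuffle br) aug k (basis w)"
  have "Sum_any (\<lambda>k. ?P k when 2 \<le> k) = (\<Sum>k\<in>{..Suc (length w)}. ?P k when 2 \<le> k)"
  proof (rule Sum_any.expand_superset)
    show "{k. (?P k when 2 \<le> k) \<noteq> 0} \<subseteq> {..Suc (length w)}"
    proof
      fix k
      assume "k \<in> {k. (?P k when 2 \<le> k) \<noteq> 0}"
      then have "conv_pow (qshuffle br) aug k (basis w) \<noteq> 0"
        by (auto simp: when_def split: if_splits)
      then show "k \<in> {..Suc (length w)}"
        using conv_pow_aug_eq_0[of w k br] by (cases "length w < k") auto
    qed
  qed simp
  also have "\<dots> = (\<Sum>k\<in>{..Suc (length w)}. ?P k - (?P k when k < 2))"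
    by (intro sum.cong) (auto simp: when_def)
  also have "\<dots> = qs_antipode br (basis w) - (\<Sum>k\<in>{..Suc (length w)}. ?P k when k < 2)"
    using alternating_conv_pow_aug[OF assms(1), of "Suc (length w)"] by (simp add: sum_subtractf del: sum.atMost_Suc)
  also have "(\<Sum>k\<in>{..Suc (length w)}. ?P k when k < 2) = (\<Sum>k\<in>{0, 1}. ?P k)"
    by (rule sum.mono_neutral_cong_right) (auto simp: when_def)
  also have "\<dots> = - basis w"
    using assms(2) conv_pow_aug_1[of w br] by (simp add: conv_unit_basis)
  finally show ?thesis
    using assms(2) by (simp add: coshlog_def conv_unit_basis add.commute)
qed

end

lemma bracket_word_trivial: "2 \<le> length w \<Longrightarrow> bracket_word (\<lambda>a b. 0) w = 0"
proof -
  assume "2 \<le> length w"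
  then obtain a b w' where "w = a # b # w'"
    by (auto simp: numeral_2_eq_2 Suc_le_length_iff)
  then show ?thesis
    by (simp add: letter_mult_def linext_def)
qed

lemma bracket_sum_trivial: "bracket_sum (\<lambda>a b. 0) (rev w) = basis (rev w)"
proof (induction w)
  case (Cons a w)
  let ?f = "\<lambda>k. conc (bracket_sum (\<lambda>a b. 0) (rev (drop k (a # w))))
    (of_letters (bracket_word (\<lambda>a b. 0) (rev (take k (a # w)))))"
  have "bracket_sum (\<lambda>a b. 0) (rev (a # w)) = (\<Sum>k=1..length (a # w). ?f k)"
    by (rule bracket_sum_rev) simp
  also have "\<dots> = (\<Sum>k\<in>{1}. ?f k)"
    by (intro sum.mono_neutral_right)
       (auto simp: bracket_word_trivial linear_0 bilinear_rzero[OF bilinear_conc])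
  finally show ?case
    by (simp add: Cons.IH)
qed simp

lemma qs_antipode_trivial: "qs_antipode (\<lambda>a b. 0) (basis w) = sign_reverse (basis w)"
  by (simp add: qs_antipode_basis bracket_sum_trivial sign_reverse_def)

lemma coshlog_shuffle:
  assumes "w \<noteq> []"
  shows "coshlog shuffle (basis w) = (1 / 2) *\<^sub>R (basis w + sign_reverse (basis w))"
proof -
  interpret bracket_alphabet UNIV "\<lambda>a b :: 'a. 0"
    by unfold_locales
       (simp_all add: bilinear_lzero[OF bilinear_letter_mult] bilinear_rzero[OF bilinear_letter_mult])
  show ?thesis
    using coshlog_qshuffle[of w] assms by (simp add: shuffle_def qs_antipode_trivial)
qed

lemma direct_mti_antisym_sign_reverse:
  "direct_mti n antisym_sign_reverse (basis w) =
    (if length w \<le> n then basis w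
     else if length w = n + 1 then (1 / 2) *\<^sub>R (basis w + sign_reverse (basis w)) else 0)"
proof -
  have lin: "linear (word_proj P :: 'a endo)" for P
    by (simp add: word_proj_def)
  have proj: "word_proj P (basis v) = (if P v then basis v else 0)" for P and v :: "'a list"
    by (simp add: word_proj_def)
  have half: "p - (1 / 2) *\<^sub>R (p - q) = (1 / 2) *\<^sub>R (p + q)" for p q :: "'a ncpoly"
    using scaleR_left_distrib[of "1 / 2" "1 / 2" p] by (simp add: algebra_simps)
  have "aug (basis w) - antisym_sign_reverse (basis w) =
      (1 / 2) *\<^sub>R (basis w + sign_reverse (basis w))" if "w \<noteq> []"
    using that by (simp add: aug_basis antisym_sign_reverse_def half)
  moreover have "word_proj (\<lambda>v. length v = n + 1) (sign_reverse (basis w)) =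
      (if length w = n + 1 then sign_reverse (basis w) else 0)"
    by (simp add: sign_reverse_def linear_scale[OF lin] proj)
  moreover have "aug (basis []) - antisym_sign_reverse (basis []) = (0 :: 'a ncpoly)"
    by (simp add: aug_basis antisym_sign_reverse_def sign_reverse_def)
  ultimately show ?thesis
    unfolding direct_mti_def
    by (cases "w = []") (auto simp: proj linear_add[OF lin] linear_scale[OF lin] linear_0[OF lin])
qed

lemma integral_ext_basis: "integral_ext I (basis w) t \<omega> = I w t \<omega>"
  by (simp add: integral_ext_def)

lemma expansion_has_value_truncated:
  assumes "\<And>w. w \<in> L \<Longrightarrow> length w \<le> n \<Longrightarrow> c w = c1 w"
    and "\<And>w. w \<in> L \<Longrightarrow> length w = n + 1 \<Longrightarrow> c w = c2 w"
    and "\<And>w. w \<in> L \<Longrightarrow> n + 1 < length w \<Longrightarrow> c w = 0"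
  shows "expansion_has_value D L c f y x \<longleftrightarrow> (\<exists>x1 x2. x = x1 + x2 \<and>
    expansion_has_value D {w \<in> L. length w \<le> n} c1 f y x1 \<and>
    expansion_has_value D {w \<in> L. length w = n + 1} c2 f y x2)"
proof -
  let ?h = "\<lambda>w. c w * word_op D w f y"
  let ?L1 = "{w \<in> L. length w \<le> n}" and ?L2 = "{w \<in> L. length w = n + 1}"
  have "expansion_has_value D L c f y x \<longleftrightarrow> (?h has_sum x) (?L1 \<union> ?L2)"
    unfolding expansion_has_value_def using assms(3) by (intro has_sum_cong_neutral) auto
  also have "\<dots> \<longleftrightarrow> (\<exists>x1 x2. x = x1 + x2 \<and> (?h has_sum x1) ?L1 \<and> (?h has_sum x2) ?L2)"
  proof
    assume *: "(?h has_sum x) (?L1 \<union> ?L2)"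
    then have "?h summable_on ?L1 \<union> ?L2"
      by (rule has_sum_imp_summable)
    then have "?h summable_on ?L1" "?h summable_on ?L2"
      by (auto elim: summable_on_subset_banach)
    then obtain x1 x2 where **: "(?h has_sum x1) ?L1" "(?h has_sum x2) ?L2"
      by (auto simp: summable_on_def)
    then have "(?h has_sum (x1 + x2)) (?L1 \<union> ?L2)"
      by (rule has_sum_Un_disjoint) auto
    with * ** show "\<exists>x1 x2. x = x1 + x2 \<and> (?h has_sum x1) ?L1 \<and> (?h has_sum x2) ?L2"
      using has_sum_unique by blast
  next
    assume "\<exists>x1 x2. x = x1 + x2 \<and> (?h has_sum x1) ?L1 \<and> (?h has_sum x2) ?L2"
    then obtain x1 x2 where "x = x1 + x2" "(?h has_sum x1) ?L1" "(?h has_sum x2) ?L2"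
      by blast
    then show "(?h has_sum x) (?L1 \<union> ?L2)"
      by (auto intro!: has_sum_Un_disjoint)
  qed
  also have "\<dots> \<longleftrightarrow> (\<exists>x1 x2. x = x1 + x2 \<and>
    expansion_has_value D ?L1 c1 f y x1 \<and> expansion_has_value D ?L2 c2 f y x2)"
  proof -
    have "(?h has_sum z) ?L1 \<longleftrightarrow> expansion_has_value D ?L1 c1 f y z" for z
      unfolding expansion_has_value_def using assms(1) by (intro has_sum_cong) auto
    moreover have "(?h has_sum z) ?L2 \<longleftrightarrow> expansion_has_value D ?L2 c2 f y z" for z
      unfolding expansion_has_value_def using assms(2) by (intro has_sum_cong) auto
    ultimately show ?thesis
      by simp
  qed
  finally show ?thesis .
qed

theorem lemma3:
  fixes M :: "'o measure" and F :: "real \<Rightarrow> 'o measure" and d l n :: nat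
    and V :: "nat \<Rightarrow> real ^ 'N \<Rightarrow> real ^ 'N" and f :: "real ^ 'N \<Rightarrow> real"
    and t x :: real and y :: "real ^ 'N" and \<omega> :: 'o
  assumes "levy_ito_setting M F d l W Q \<rho> J br I V \<phi> T D"
    and "0 \<le> t" and "f \<in> T" and "\<omega> \<in> space M"
  shows "(expansion_has_value D (lists (alphabet M d l J))
           (\<lambda>w. integral_ext I (direct_mti n antisym_sign_reverse (basis w)) t \<omega>) f y x
         \<longleftrightarrow>
         (\<exists>x1 x2. x = x1 + x2 \<and>
           expansion_has_value D {w \<in> lists (alphabet M d l J). length w \<le> n}
             (\<lambda>w. I w t \<omega>) f y x1 \<and>
           expansion_has_value D {w \<in> lists (alphabet M d l J). length w = n + 1}
             (\<lambda>w. integral_ext I (coshlog shuffle (basis w)) t \<omega>) f y x2))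
         \<and>
         (expansion_has_value D (lists (alphabet M d l J))
           (\<lambda>w. integral_ext I (direct_mti n antisym_sign_reverse (basis w)) t \<omega>) f y x
         \<longleftrightarrow>
         (\<exists>x1 x2. x = x1 + x2 \<and>
           expansion_has_value D {w \<in> lists (alphabet M d l J). length w \<le> n}
             (\<lambda>w. I w t \<omega>) f y x1 \<and>
           expansion_has_value D {w \<in> lists (alphabet M d l J). length w = n + 1}
             (\<lambda>w. integral_ext I (coshlog (qshuffle br) (basis w)) t \<omega>
                + (1 / 2) * integral_ext I (sign_reverse (basis w) - qs_antipode br (basis w)) t \<omega>)
             f y x2))"
proof -
  interpret levy_ito_setting M F d l W Q \<rho> J br I V \<phi> T D
    by fact
  interpret bracket_alphabet "alphabet M d l J" br
    by unfold_locales (fact br_closed br_commute br_assoc)+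
  have linI: "linear (\<lambda>p. integral_ext I p t \<omega>)"
    by (simp add: integral_ext_def)
  note I_simps = integral_ext_basis linear_0[OF linI] linear_add[OF linI] linear_diff[OF linI]
    linear_scale[OF linI]
  have nonempty: "w \<noteq> []" if "length w = Suc n" for w :: "letter list"
    using that by auto
  have "expansion_has_value D (lists (alphabet M d l J))
      (\<lambda>w. integral_ext I (direct_mti n antisym_sign_reverse (basis w)) t \<omega>) f y x \<longleftrightarrow>
    (\<exists>x1 x2. x = x1 + x2 \<and>
      expansion_has_value D {w \<in> lists (alphabet M d l J). length w \<le> n} (\<lambda>w. I w t \<omega>) f y x1 \<and>
      expansion_has_value D {w \<in> lists (alphabet M d l J). length w = n + 1} c f y x2)"
    if "\<And>w. set w \<subseteq> alphabet M d l J \<Longrightarrow> w \<noteq> [] \<Longrightarrow>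
      c w = (1 / 2) * (I w t \<omega> + integral_ext I (sign_reverse (basis w)) t \<omega>)" for c
    by (intro expansion_has_value_truncated)
       (auto simp: direct_mti_antisym_sign_reverse I_simps that subset_iff nonempty)
  then show ?thesis
    by (intro conjI)
       (simp_all add: coshlog_shuffle coshlog_qshuffle I_simps field_simps)
qed

end
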